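(* Let $\Bbbk$ be a field. For all integers $r,s\ge0$, let $X=\mathcal K_r\ast\overline{\mathcal K_s}$ be the complete split graph and let $R$ be the polynomial ring over $\Bbbk$ in the $r+s$ variables given by the vertices of $X$. For all integers $q$ with $1\le q\le\nu(X)=\min\big(r,\lfloor(r+s)/2\rfloor\big)$, the Krull dimension satisfies \[ \dim\big(R/I(X)^{[q]}\big)=(q-1)+\max(q,s). \]
   Context: The complete split graph $\mathcal K_r\ast\overline{\mathcal K_s}$ consists of a clique on $r$ vertices and an independent set on $s$ further vertices, with all edges between the two parts. $\nu(X)$ denotes the matching number of a graph $X$ (maximum number of pairwise vertex-disjoint edges). A $q$-matching is a set $M$ of $q$ pairwise vertex-disjoint edges, and $V(M)$ is the set of vertices it covers. For a graph $X$, the $q$-th squarefree power $I(X)^{[q]}$ is the ideal, in the polynomial ring over $\Bbbk$ whose variables are the vertices of $X$, generated by all monomials $\prod_{u\in V(M)}u$ with $M$ a $q$-matching of $X$. *)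

theory Defs
  imports
    "HOL-Algebra.QuotRing"
    "HOL-Library.Poly_Mapping"
    "HOL-Library.Extended_Real"
    "HOL-Library.Disjoint_Sets"
begin

(* A graph is a pair of a vertex set and a set of two-element edges. *)
type_synonym 'v graph = "'v set \<times> 'v set set"

abbreviation verts :: "'v graph \<Rightarrow> 'v set" where
  "verts X \<equiv> fst X"

abbreviation edges :: "'v graph \<Rightarrow> 'v set set" where
  "edges X \<equiv> snd X"

(* The clique lives on {..<r}, the independent set on {r..<r+s}. *)
definition complete_split :: "nat \<Rightarrow> nat \<Rightarrow> nat graph" where
  "complete_split r s =
     ({..<r + s},
      {{u, v} | u v. u \<in> {..<r} \<and> v \<in> {..<r} \<and> u \<noteq> v} \<union>
      {{u, v} | u v. u \<in> {..<r} \<and> v \<in> {r..<r + s}})"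

definition q_matching :: "'v graph \<Rightarrow> nat \<Rightarrow> 'v set set \<Rightarrow> bool" where
  "q_matching X q M \<longleftrightarrow> M \<subseteq> edges X \<and> finite M \<and> card M = q \<and> disjoint M"

(* Meaningful for graphs with finitely many edges. *)
definition matching_number :: "'v graph \<Rightarrow> nat" where
  "matching_number X = Max {q. \<exists>M. q_matching X q M}"

(* Finitely supported maps from exponent vectors to coefficients, with the convolution product. *)
type_synonym ('v, 'k) mpoly = "('v \<Rightarrow>\<^sub>0 nat) \<Rightarrow>\<^sub>0 'k"

definition var :: "'v \<Rightarrow> ('v, 'k :: comm_ring_1) mpoly" where
  "var u = Poly_Mapping.single (Poly_Mapping.single u 1) 1"

(* Polynomials over the coefficient type in the variables from V only. *)
definition poly_ring :: "'v set \<Rightarrow> ('v, 'k :: comm_ring_1) mpoly ring" where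
  "poly_ring V =
     \<lparr>carrier = {p. \<forall>m \<in> Poly_Mapping.keys p. Poly_Mapping.keys m \<subseteq> V},
      monoid.mult = (*), one = 1, ring.zero = 0, add = (+)\<rparr>"

definition squarefree_power :: "'v graph \<Rightarrow> nat \<Rightarrow> ('v, 'k :: comm_ring_1) mpoly set" where
  "squarefree_power X q =
     Idl\<^bsub>poly_ring (verts X)\<^esub> {\<Prod>u\<in>\<Union>M. var u | M. q_matching X q M}"

(* Supremum of the lengths n of chains P 0 < ... < P n of prime ideals;
   the zero ring has no prime ideals and gets dimension -\<infinity>. *)
definition krull_dim :: "('a, 'm) ring_scheme \<Rightarrow> ereal" where
  "krull_dim R =
     Sup {ereal (real n) | n. \<exists>P :: nat \<Rightarrow> 'a set.
            (\<forall>i\<le>n. primeideal (P i) R) \<and> (\<forall>i<n. P i \<subset> P (Suc i))}"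

end

theory Submission
  imports Defs
begin

text \<open>The ideal in question is generated by squarefree monomials, and for such an ideal the Krull
  dimension of the quotient is combinatorial: it is the largest size of a face, a set of variables
  that contains the support of no generator (\<open>krull_dim_squarefree_monomial_ideal\<close>).

  A face \<open>F\<close> gives a chain of length \<open>card F\<close>: remove its elements one at a time and take, for each
  of the resulting sets, the prime ideal generated by the variables outside it. Conversely, let
  \<open>P 0 \<subset> \<dots> \<subset> P n\<close> be primes containing the ideal. Since \<open>P 0\<close> is prime, it contains a
  variable of each generator, so the variables not in \<open>P 0\<close> form a face \<open>F\<close>, and \<open>n \<le> card F\<close>
  has to be shown (\<open>prime_chain_length_le\<close>). This is the classical bound on the dimension of a
  polynomial ring in \<open>card F\<close> variables, and it has an elementary proof. Choose
  \<open>f i \<in> P (Suc i) - P i\<close>; modulo \<open>P 0\<close> these may be taken to be polynomials in the variables of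
  \<open>F\<close> alone. If \<open>n > card F\<close>, then \<open>f 0, \<dots>, f (n - 1)\<close> are algebraically dependent, by counting
  monomials of bounded exponents (\<open>algebraic_dependence\<close>). But no nonzero polynomial vanishes at
  them (\<open>nonzero_polynomial_notin_chain\<close>): after dividing by the highest possible power of \<open>f 0\<close>,
  which is not in \<open>P 0\<close>, the rest is a polynomial in \<open>f 1, f 2, \<dots>\<close> plus a multiple of
  \<open>f 0 \<in> P 1\<close>, and the argument repeats one step higher in the chain, until a nonzero constant
  is left.

  In the complete split graph every edge has an endpoint in the clique, and any two vertices of which
  one is in the clique are adjacent. So a vertex set contains the vertices of a \<open>q\<close>-matching
  exactly if it has at least \<open>2 q\<close> elements, at least \<open>q\<close> of them in the clique
  (\<open>contains_matched_set_iff\<close>). The faces are therefore the sets with at most \<open>2 q - 1\<close> elements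
  and those with at most \<open>q - 1\<close> clique vertices. The largest ones have \<open>2 q - 1\<close> elements or
  \<open>(q - 1) + s\<close> elements, whichever is larger, which gives \<open>(q - 1) + max q s\<close>.\<close>

section \<open>Polynomial rings and their prime ideals\<close>

lemma mem_carrier_poly_ring:
  "p \<in> carrier (poly_ring V) \<longleftrightarrow> (\<forall>m \<in> Poly_Mapping.keys p. Poly_Mapping.keys m \<subseteq> V)"
  by (simp add: poly_ring_def)

lemma poly_ring_sel [simp]:
  "mult (poly_ring V) = (*)" "one (poly_ring V) = 1"
  "zero (poly_ring V) = 0" "add (poly_ring V) = (+)"
  by (simp_all add: poly_ring_def)

lemma keys_plus_nat: "Poly_Mapping.keys (a + b) = Poly_Mapping.keys a \<union> Poly_Mapping.keys b"
  for a b :: "'v \<Rightarrow>\<^sub>0 nat"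
  by (auto simp: in_keys_iff lookup_add)

lemma keys_mult_E:
  assumes "m \<in> Poly_Mapping.keys (p * q)"
  obtains a b where "a \<in> Poly_Mapping.keys p" "b \<in> Poly_Mapping.keys q" "m = a + b"
  using keys_mult[of p q] assms by auto

lemma poly_ring_const: "Poly_Mapping.single 0 c \<in> carrier (poly_ring V)"
  by (simp add: mem_carrier_poly_ring)

lemma poly_ring_var: "v \<in> V \<Longrightarrow> var v \<in> carrier (poly_ring V)"
  by (simp add: mem_carrier_poly_ring var_def)

lemma poly_ring_add:
  "p \<in> carrier (poly_ring V) \<Longrightarrow> q \<in> carrier (poly_ring V) \<Longrightarrow> p + q \<in> carrier (poly_ring V)"
  unfolding mem_carrier_poly_ring using keys_add[of p q] by blast

lemma poly_ring_uminus:
  "p \<in> carrier (poly_ring V) \<Longrightarrow> - p \<in> carrier (poly_ring V)"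
  by (simp add: mem_carrier_poly_ring in_keys_iff[where 'a = "'a \<Rightarrow>\<^sub>0 nat"])

lemma poly_ring_mult:
  "p \<in> carrier (poly_ring V) \<Longrightarrow> q \<in> carrier (poly_ring V) \<Longrightarrow> p * q \<in> carrier (poly_ring V)"
  unfolding mem_carrier_poly_ring
  by (metis (no_types, lifting) Un_least keys_mult_E keys_plus_nat)

lemma poly_ring_one: "1 \<in> carrier (poly_ring V)"
  by (simp add: mem_carrier_poly_ring)

lemma poly_ring_zero: "0 \<in> carrier (poly_ring V)"
  by (simp add: mem_carrier_poly_ring)

lemma poly_ring_power:
  "p \<in> carrier (poly_ring V) \<Longrightarrow> p ^ k \<in> carrier (poly_ring V)"
  by (induction k) (auto simp: poly_ring_one poly_ring_mult)

lemma poly_ring_sum: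
  "(\<And>i. i \<in> I \<Longrightarrow> p i \<in> carrier (poly_ring V)) \<Longrightarrow> sum p I \<in> carrier (poly_ring V)"
  by (induction I rule: infinite_finite_induct)
     (auto simp: poly_ring_add poly_ring_zero)

lemma poly_ring_prod:
  "(\<And>i. i \<in> I \<Longrightarrow> p i \<in> carrier (poly_ring V)) \<Longrightarrow> prod p I \<in> carrier (poly_ring V)"
  by (induction I rule: infinite_finite_induct) (auto simp: poly_ring_one poly_ring_mult)

lemmas poly_ring_closed = poly_ring_const poly_ring_var poly_ring_add poly_ring_uminus
  poly_ring_mult poly_ring_one poly_ring_power poly_ring_sum poly_ring_prod

lemma cring_poly_ring: "cring (poly_ring V :: ('a, 'b :: comm_ring_1) mpoly ring)"
proof (rule cringI)
  have "\<exists>y\<in>carrier (poly_ring V). y + x = 0" if "x \<in> carrier (poly_ring V)"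
    for x :: "('a, 'b) mpoly"
    using that by (intro bexI[of _ "- x"]) (auto simp: poly_ring_uminus)
  then show "abelian_group (poly_ring V :: ('a, 'b) mpoly ring)"
    by (intro abelian_groupI) (auto simp: poly_ring_add poly_ring_zero ac_simps)
  show "comm_monoid (poly_ring V :: ('a, 'b) mpoly ring)"
    by unfold_locales (auto simp: poly_ring_mult poly_ring_one ac_simps)
qed (auto simp: algebra_simps)

text \<open>The record operations of \<open>poly_ring V\<close> are those of the type of polynomials. The facts below
  restate the closure properties of a prime ideal for the latter, so that the sums, products and
  powers of the type can be used.\<close>

locale poly_prime =
  fixes P :: "('v, 'k :: comm_ring_1) mpoly set" and V
  assumes prime: "primeideal P (poly_ring V)"
begin

sublocale primeideal P "poly_ring V" by (rule prime)

lemma one_notin: "1 \<notin> P"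
  using one_imp_carrier I_notcarr by auto

lemma zero_in: "0 \<in> P"
  using additive_subgroup.zero_closed[OF is_additive_subgroup] by simp

lemma mult_in: "p \<in> P \<Longrightarrow> q \<in> carrier (poly_ring V) \<Longrightarrow> q * p \<in> P"
  using I_l_closed by simp

lemma add_in: "p \<in> P \<Longrightarrow> q \<in> P \<Longrightarrow> p + q \<in> P"
  using additive_subgroup.a_closed[OF is_additive_subgroup] by simp

lemma uminus_in: "p \<in> P \<Longrightarrow> - p \<in> P"
  using mult_in[of p "-1"] by (simp add: poly_ring_uminus poly_ring_one)

lemma add_in_iff: "q \<in> P \<Longrightarrow> p + q \<in> P \<longleftrightarrow> p \<in> P"
  using add_in[of p q] add_in[of "p + q" "- q"] uminus_in[of q] by auto

lemma sum_in: "(\<And>i. i \<in> I \<Longrightarrow> p i \<in> P) \<Longrightarrow> sum p I \<in> P"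
  by (induction I rule: infinite_finite_induct) (auto simp: zero_in add_in)

lemma cancel_notin_factor:
  "p \<in> carrier (poly_ring V) \<Longrightarrow> q \<in> carrier (poly_ring V) \<Longrightarrow> p * q \<in> P \<Longrightarrow> p \<notin> P \<Longrightarrow> q \<in> P"
  using I_prime[of p q] by auto

lemma prod_notin:
  assumes "\<And>i. i \<in> I \<Longrightarrow> p i \<in> carrier (poly_ring V)" "\<And>i. i \<in> I \<Longrightarrow> p i \<notin> P"
  shows "prod p I \<notin> P"
  using assms
proof (induction I rule: infinite_finite_induct)
  case (insert i I)
  have "p i * prod p I \<notin> P"
  proof
    assume "p i * prod p I \<in> P"
    then have "prod p I \<in> P"
      by (rule cancel_notin_factor[rotated 2]) (use insert.prems in \<open>auto intro: poly_ring_prod\<close>)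
    then show False using insert.IH insert.prems by blast
  qed
  then show ?case using insert.hyps by simp
qed (simp_all add: one_notin)

lemma power_notin:
  "p \<in> carrier (poly_ring V) \<Longrightarrow> p \<notin> P \<Longrightarrow> p ^ k \<notin> P"
  using prod_notin[of "{..<k}" "\<lambda>_. p"] by simp

end

text \<open>The ideal generated by the variables in \<open>V - F\<close>. Describing it by the monomials that occur lets
  membership be read off the support of a polynomial.\<close>

definition coordinate_ideal :: "'v set \<Rightarrow> 'v set \<Rightarrow> ('v, 'k :: comm_ring_1) mpoly set" where
  "coordinate_ideal V F =
     {p \<in> carrier (poly_ring V). \<forall>m \<in> Poly_Mapping.keys p. \<not> Poly_Mapping.keys m \<subseteq> F}"

text \<open>Sorting the monomials according to whether they lie in \<open>F\<close> replaces the substitution that sends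
  the variables outside \<open>F\<close> to zero: \<open>a\<close> is the value of \<open>p\<close> under it and \<open>b\<close> is in its kernel.\<close>

lemma split_by_support:
  fixes p :: "('v, 'k :: comm_ring_1) mpoly"
  assumes "p \<in> carrier (poly_ring V)"
  obtains a b where "p = a + b" "a \<in> carrier (poly_ring F)" "a \<in> carrier (poly_ring V)"
    "b \<in> coordinate_ideal V F"
proof -
  define a where "a = Poly_Mapping.mapp (\<lambda>m c. c when Poly_Mapping.keys m \<subseteq> F) p"
  have la: "Poly_Mapping.lookup a m = (Poly_Mapping.lookup p m when Poly_Mapping.keys m \<subseteq> F)" for m
    by (auto simp: a_def lookup_mapp when_def in_keys_iff)
  show ?thesis
  proof (rule that[of a "p - a"])
    show "a \<in> carrier (poly_ring F)" "a \<in> carrier (poly_ring V)"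
      using assms by (auto simp: mem_carrier_poly_ring in_keys_iff[of _ a] in_keys_iff[of _ p] la
          when_def split: if_splits)
    show "p - a \<in> coordinate_ideal V F"
      using assms by (auto simp: coordinate_ideal_def mem_carrier_poly_ring in_keys_iff[of _ "p - a"]
          in_keys_iff[of _ p] la when_def lookup_minus split: if_splits)
  qed simp
qed

lemma ideal_coordinate_ideal:
  "ideal (coordinate_ideal V F :: ('v, 'k :: comm_ring_1) mpoly set) (poly_ring V)"
proof -
  let ?J = "coordinate_ideal V F :: ('v, 'k) mpoly set"
  interpret cring "poly_ring V :: ('v, 'k) mpoly ring" by (rule cring_poly_ring)
  have mult: "x * a \<in> ?J" if "a \<in> ?J" "x \<in> carrier (poly_ring V)" for a x
    using that unfolding coordinate_ideal_def
    by (auto simp: poly_ring_mult keys_plus_nat elim!: keys_mult_E)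
  have add: "a + b \<in> ?J" if "a \<in> ?J" "b \<in> ?J" for a b
    using that keys_add[of a b] by (auto simp: coordinate_ideal_def poly_ring_add)
  show ?thesis
  proof (rule idealI)
    show "subgroup ?J (add_monoid (poly_ring V))"
    proof (rule group.subgroupI)
      show "Group.group (add_monoid (poly_ring V :: ('v, 'k) mpoly ring))"
        by (rule a_group)
      have "0 \<in> ?J" by (simp add: coordinate_ideal_def mem_carrier_poly_ring)
      then show "?J \<noteq> {}" by blast
      fix a assume a: "a \<in> ?J"
      then have "a \<in> carrier (poly_ring V)" by (simp add: coordinate_ideal_def)
      then have "inv\<^bsub>add_monoid (poly_ring V)\<^esub> a = - a"
        using minus_equality[of "- a" a] by (simp add: a_inv_def poly_ring_uminus)
      moreover have "- a \<in> ?J"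
        using mult[OF a, of "- 1"] by (simp add: poly_ring_uminus poly_ring_one)
      ultimately show "inv\<^bsub>add_monoid (poly_ring V)\<^esub> a \<in> ?J" by simp
    qed (auto simp: add, auto simp: coordinate_ideal_def)
    show "a \<otimes>\<^bsub>poly_ring V\<^esub> x \<in> ?J" if "a \<in> ?J" "x \<in> carrier (poly_ring V)" for a x
      using mult[OF that] by (simp add: mult.commute)
  qed (auto simp: ring_axioms mult)
qed

text \<open>Modulo the ideal, each factor may be replaced by its part in the variables of \<open>F\<close>. The product
  of these parts again involves only \<open>F\<close>, so it lies in the ideal only if it is zero, and
  polynomials over an integral domain have no zero divisors.\<close>

lemma primeideal_coordinate_ideal:
  "primeideal (coordinate_ideal V F :: ('v :: linorder, 'k :: idom) mpoly set) (poly_ring V)"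
proof (rule primeidealI)
  let ?J = "coordinate_ideal V F :: ('v, 'k) mpoly set"
  show J: "ideal ?J (poly_ring V)" by (rule ideal_coordinate_ideal)
  show "cring (poly_ring V :: ('v, 'k) mpoly ring)" by (rule cring_poly_ring)
  have "1 \<notin> ?J" by (simp add: coordinate_ideal_def)
  then show "carrier (poly_ring V) \<noteq> ?J" using poly_ring_one[of V] by metis
  fix p q :: "('v, 'k) mpoly"
  assume p: "p \<in> carrier (poly_ring V)" and q: "q \<in> carrier (poly_ring V)"
    and pq: "p \<otimes>\<^bsub>poly_ring V\<^esub> q \<in> ?J"
  interpret J: ideal ?J "poly_ring V" by (rule J)
  obtain a b where ab: "p = a + b" "a \<in> carrier (poly_ring F)" "a \<in> carrier (poly_ring V)" "b \<in> ?J"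
    using p by (rule split_by_support)
  obtain c d where cd: "q = c + d" "c \<in> carrier (poly_ring F)" "c \<in> carrier (poly_ring V)" "d \<in> ?J"
    using q by (rule split_by_support)
  have "a * d + b * q \<in> ?J"
    using J.I_l_closed[OF cd(4) ab(3)] J.I_r_closed[OF ab(4) q]
      additive_subgroup.a_closed[OF J.is_additive_subgroup] by simp
  then have "- (a * d + b * q) \<in> ?J"
    using J.I_l_closed[of "a * d + b * q" "- 1"] by (simp add: poly_ring_uminus poly_ring_one)
  then have "p * q + - (a * d + b * q) \<in> ?J"
    using additive_subgroup.a_closed[OF J.is_additive_subgroup] pq by simp
  also have "p * q + - (a * d + b * q) = a * c"
    by (simp add: ab(1) cd(1) algebra_simps)
  finally have "a * c \<in> ?J" .
  moreover have "a * c \<in> carrier (poly_ring F)"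
    using ab(2) cd(2) by (rule poly_ring_mult)
  ultimately have "Poly_Mapping.keys (a * c) = {}"
    by (auto simp: coordinate_ideal_def mem_carrier_poly_ring)
  then have "a * c = 0" by simp
  then have "a = 0 \<or> c = 0" by simp
  then show "p \<in> ?J \<or> q \<in> ?J" using ab(1,4) cd(1,4) by auto
qed

lemma monomial_divisible:
  fixes m :: "'v \<Rightarrow>\<^sub>0 nat" and c :: "'k :: comm_ring_1"
  assumes "v \<in> Poly_Mapping.keys m"
  shows "Poly_Mapping.single m c =
    Poly_Mapping.single (m - Poly_Mapping.single v 1) c * var v"
proof -
  have "m - Poly_Mapping.single v 1 + Poly_Mapping.single v 1 = m"
    using assms by (intro poly_mapping_eqI)
      (auto simp: lookup_add lookup_minus lookup_single in_keys_iff when_def)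
  then show ?thesis by (simp add: var_def mult_single)
qed

lemma poly_sum_monomials:
  "p = (\<Sum>m\<in>Poly_Mapping.keys p. Poly_Mapping.single m (Poly_Mapping.lookup p m))"
  by (intro poly_mapping_eqI)
    (auto simp: lookup_sum lookup_single when_def in_keys_iff sum.delta' sum.delta)

lemma coordinate_ideal_subset_prime:
  fixes P :: "('v, 'k :: comm_ring_1) mpoly set"
  assumes "primeideal P (poly_ring V)" and "\<And>v. v \<in> V \<Longrightarrow> v \<notin> F \<Longrightarrow> var v \<in> P"
  shows "coordinate_ideal V F \<subseteq> P"
proof
  interpret poly_prime P V by (rule poly_prime.intro) fact
  fix p :: "('v, 'k) mpoly" assume p: "p \<in> coordinate_ideal V F"
  have "Poly_Mapping.single m (Poly_Mapping.lookup p m) \<in> P"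
    if m: "m \<in> Poly_Mapping.keys p" for m
  proof -
    from p m have mV: "Poly_Mapping.keys m \<subseteq> V" and "\<not> Poly_Mapping.keys m \<subseteq> F"
      by (auto simp: coordinate_ideal_def mem_carrier_poly_ring)
    then obtain v where v: "v \<in> Poly_Mapping.keys m" "v \<in> V" "v \<notin> F" by auto
    have "Poly_Mapping.keys (m - Poly_Mapping.single v 1) \<subseteq> V"
      using mV by (auto simp: in_keys_iff lookup_minus)
    then have "Poly_Mapping.single (m - Poly_Mapping.single v 1) (Poly_Mapping.lookup p m)
        \<in> carrier (poly_ring V)"
      by (simp add: mem_carrier_poly_ring)
    then show ?thesis
      unfolding monomial_divisible[OF v(1)] by (intro mult_in assms(2)[OF v(2,3)])
  qed
  then show "p \<in> P" by (subst poly_sum_monomials[of p]) (rule sum_in)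
qed

lemma coordinate_ideal_antimono: "F' \<subseteq> F \<Longrightarrow> coordinate_ideal V F \<subseteq> coordinate_ideal V F'"
  by (auto simp: coordinate_ideal_def)

lemma var_mem_coordinate_ideal:
  "v \<in> V \<Longrightarrow> var v \<in> (coordinate_ideal V F :: ('v, 'k :: comm_ring_1) mpoly set) \<longleftrightarrow> v \<notin> F"
  by (auto simp: coordinate_ideal_def mem_carrier_poly_ring var_def)

section \<open>Algebraic dependence of many polynomials in few variables\<close>

text \<open>Gaussian elimination: an equation with a nonzero coefficient eliminates one unknown, and the
  elimination leaves one equation and one unknown less.\<close>

lemma homogeneous_system_nontrivial_solution:
  fixes M :: "'a \<Rightarrow> 'b \<Rightarrow> 'k :: field"
  assumes "finite A" "finite B" "card A < card B"
  shows "\<exists>x. (\<exists>b\<in>B. x b \<noteq> 0) \<and> (\<forall>a\<in>A. (\<Sum>b\<in>B. M a b * x b) = 0)"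
  using assms
proof (induction A arbitrary: B M rule: finite_induct)
  case empty
  then have "B \<noteq> {}" by auto
  then show ?case by (intro exI[of _ "\<lambda>_. 1"]) auto
next
  case (insert a A)
  show ?case
  proof (cases "\<forall>b\<in>B. M a b = 0")
    case True
    then show ?thesis using insert.IH[of B M] insert.prems insert.hyps by auto
  next
    case False
    then obtain b where b: "b \<in> B" "M a b \<noteq> 0" by auto
    define M' where "M' = (\<lambda>a' b'. M a' b' - M a' b * M a b' / M a b)"
    have "card A < card (B - {b})" using insert.prems insert.hyps b by simp
    then obtain x where x: "\<exists>b'\<in>B - {b}. x b' \<noteq> 0"
      "\<And>a'. a' \<in> A \<Longrightarrow> (\<Sum>b'\<in>B - {b}. M' a' b' * x b') = 0"
      using insert.IH[of "B - {b}" M'] insert.prems by auto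
    define y where "y = x(b := - (\<Sum>b'\<in>B - {b}. M a b' * x b') / M a b)"
    have sum: "(\<Sum>b'\<in>B. M a' b' * y b') = M a' b * y b + (\<Sum>b'\<in>B - {b}. M a' b' * x b')" for a'
    proof -
      have "(\<Sum>b'\<in>B. M a' b' * y b') = M a' b * y b + (\<Sum>b'\<in>B - {b}. M a' b' * y b')"
        using insert.prems(1) b(1) by (rule sum.remove)
      also have "(\<Sum>b'\<in>B - {b}. M a' b' * y b') = (\<Sum>b'\<in>B - {b}. M a' b' * x b')"
        by (intro sum.cong) (auto simp: y_def)
      finally show ?thesis .
    qed
    have "(\<Sum>b'\<in>B. M a b' * y b') = 0"
      unfolding sum using b(2) by (simp add: y_def)
    moreover have "(\<Sum>b'\<in>B. M a' b' * y b') = 0" if "a' \<in> A" for a'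
    proof -
      have "0 = (\<Sum>b'\<in>B - {b}. M a' b' * x b' - M a' b / M a b * (M a b' * x b'))"
        using x(2)[OF that] by (simp add: M'_def algebra_simps)
      also have "\<dots> = (\<Sum>b'\<in>B - {b}. M a' b' * x b') - M a' b / M a b * (\<Sum>b'\<in>B - {b}. M a b' * x b')"
        by (simp add: sum_subtractf sum_distrib_left)
      also have "\<dots> = (\<Sum>b'\<in>B. M a' b' * y b')"
        unfolding sum using b(2) by (simp add: y_def)
      finally show ?thesis by simp
    qed
    moreover have "\<exists>b'\<in>B. y b' \<noteq> 0" using x(1) by (auto simp: y_def)
    ultimately show ?thesis by auto
  qed
qed

text \<open>The degrees in the single variables are bounded, rather than the total degree, so that the
  exponent vectors to be counted fill a box.\<close>

definition exponents_le :: "nat \<Rightarrow> ('v, 'k :: comm_ring_1) mpoly \<Rightarrow> bool" where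
  "exponents_le D p \<longleftrightarrow> (\<forall>m\<in>Poly_Mapping.keys p. \<forall>v. Poly_Mapping.lookup m v \<le> D)"

lemma exponents_le_one: "exponents_le 0 1"
  by (simp add: exponents_le_def)

lemma exponents_le_mono: "exponents_le a p \<Longrightarrow> a \<le> b \<Longrightarrow> exponents_le b p"
  by (auto simp: exponents_le_def intro: order_trans)

lemma exponents_le_mult: "exponents_le a p \<Longrightarrow> exponents_le b q \<Longrightarrow> exponents_le (a + b) (p * q)"
  by (auto simp: exponents_le_def lookup_add elim!: keys_mult_E intro!: add_mono)

lemma exponents_le_power: "exponents_le a p \<Longrightarrow> exponents_le (k * a) (p ^ k)"
  by (induction k) (auto simp: exponents_le_one exponents_le_mult)

lemma exponents_le_prod:
  "(\<And>i. i \<in> I \<Longrightarrow> exponents_le (a i) (p i)) \<Longrightarrow> exponents_le (sum a I) (prod p I)"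
  by (induction I rule: infinite_finite_induct) (auto simp: exponents_le_one exponents_le_mult)

lemma exponents_le_exists: "\<exists>D. exponents_le D p"
proof -
  let ?S = "\<Union>m\<in>Poly_Mapping.keys p. Poly_Mapping.lookup m ` Poly_Mapping.keys m"
  have fin: "finite (insert 0 ?S)" by simp
  have "Poly_Mapping.lookup m v \<le> Max (insert 0 ?S)" if "m \<in> Poly_Mapping.keys p" for m v
  proof (cases "v \<in> Poly_Mapping.keys m")
    case True
    then show ?thesis using that by (intro Max_ge[OF fin]) blast
  next
    case False
    then have "Poly_Mapping.lookup m v = 0" by (simp add: in_keys_iff)
    then show ?thesis by (simp only: zero_le)
  qed
  then show ?thesis unfolding exponents_le_def by blast
qed

lemma exponents_le_exists_uniform:
  assumes "finite I"
  shows "\<exists>D. \<forall>i\<in>I. exponents_le D (p i)"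
proof -
  have "\<forall>i. \<exists>D. exponents_le D (p i)" using exponents_le_exists by blast
  then obtain D where D: "\<And>i. exponents_le (D i) (p i)" by metis
  have "exponents_le (sum D I) (p i)" if "i \<in> I" for i
    by (rule exponents_le_mono[OF D]) (use assms that in \<open>auto intro: member_le_sum\<close>)
  then show ?thesis by blast
qed

lemma finite_card_monomial_box:
  assumes "finite F"
  shows "finite {m :: 'v \<Rightarrow>\<^sub>0 nat. Poly_Mapping.keys m \<subseteq> F \<and> (\<forall>v. Poly_Mapping.lookup m v \<le> B)}"
      (is "finite ?S")
    and "card {m :: 'v \<Rightarrow>\<^sub>0 nat. Poly_Mapping.keys m \<subseteq> F \<and> (\<forall>v. Poly_Mapping.lookup m v \<le> B)}
      \<le> (B + 1) ^ card F"
proof -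
  let ?g = "\<lambda>m. restrict (Poly_Mapping.lookup m) F"
  have inj: "inj_on ?g ?S"
  proof (rule inj_onI)
    fix m m' assume mm: "m \<in> ?S" "m' \<in> ?S" "?g m = ?g m'"
    show "m = m'"
    proof (rule poly_mapping_eqI)
      fix v show "Poly_Mapping.lookup m v = Poly_Mapping.lookup m' v"
      proof (cases "v \<in> F")
        case True
        then show ?thesis using fun_cong[OF mm(3), of v] by simp
      next
        case False
        then have "v \<notin> Poly_Mapping.keys m" "v \<notin> Poly_Mapping.keys m'" using mm by auto
        then show ?thesis by (simp add: in_keys_iff)
      qed
    qed
  qed
  have fin: "finite (PiE F (\<lambda>_. {..B}))" using assms by (intro finite_PiE) auto
  have sub: "?g ` ?S \<subseteq> PiE F (\<lambda>_. {..B})" by auto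
  show "finite ?S" using inj sub fin by (rule inj_on_finite)
  have "card ?S \<le> card (PiE F (\<lambda>_. {..B}))" using inj sub fin by (rule card_inj_on_le)
  also have "\<dots> = (B + 1) ^ card F" using assms by (simp add: card_PiE)
  finally show "card ?S \<le> (B + 1) ^ card F" .
qed

text \<open>Substituting \<open>f\<close> into the \<open>(N + 1) ^ n\<close> monomials in \<open>n\<close> unknowns with exponents at most \<open>N\<close>
  yields polynomials in \<open>card F\<close> variables whose exponents are at most linear in \<open>N\<close>. They live in
  a space whose dimension is a polynomial in \<open>N\<close> of degree \<open>card F < n\<close>, so for large \<open>N\<close> they
  are linearly dependent. In the result, \<open>E\<close> collects the exponent vectors whose coefficient is
  nonzero; extensionality makes them differ at an index below \<open>n\<close> if they differ at all.\<close>

lemma algebraic_dependence: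
  fixes f :: "nat \<Rightarrow> ('v, 'k :: field) mpoly"
  assumes F: "finite F" "card F < n" and f: "\<And>i. i < n \<Longrightarrow> f i \<in> carrier (poly_ring F)"
  obtains E :: "(nat \<Rightarrow> nat) set" and c where
    "finite E" "E \<noteq> {}" "E \<subseteq> extensional {..<n}" "\<And>e. e \<in> E \<Longrightarrow> c e \<noteq> 0"
    "(\<Sum>e\<in>E. Poly_Mapping.single 0 (c e) * (\<Prod>i\<in>{..<n}. f i ^ e i)) = 0"
proof -
  obtain D where D: "\<And>i. i < n \<Longrightarrow> exponents_le D (f i)"
    using exponents_le_exists_uniform[of "{..<n}" f] by auto
  define d where "d = card F"
  \<comment> \<open>With this \<open>N\<close> the number of equations is at most
    \<open>((n * D + 1) * (N + 1)) ^ d = N * (N + 1) ^ d\<close>, which is less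
    than the number \<open>(N + 1) ^ n\<close> of unknowns because \<open>d < n\<close>.\<close>
  define N where "N = (n * D + 1) ^ d"
  define B where "B = n * (N * D)"
  define mon where "mon = (\<lambda>e. \<Prod>i\<in>{..<n}. f i ^ e i)"
  define box where "box = PiE {..<n} (\<lambda>_. {..N})"
  define S where "S = {m :: 'v \<Rightarrow>\<^sub>0 nat. Poly_Mapping.keys m \<subseteq> F \<and> (\<forall>v. Poly_Mapping.lookup m v \<le> B)}"
  have keys_mon: "Poly_Mapping.keys (mon e) \<subseteq> S" if e: "e \<in> box" for e
  proof -
    have "exponents_le (\<Sum>i\<in>{..<n}. e i * D) (mon e)"
      unfolding mon_def by (intro exponents_le_prod exponents_le_power D) auto
    moreover have "(\<Sum>i\<in>{..<n}. e i * D) \<le> (\<Sum>i\<in>{..<n}. N * D)"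
      using e by (intro sum_mono mult_right_mono) (auto simp: box_def PiE_iff)
    ultimately have "exponents_le B (mon e)"
      by (auto simp: B_def intro: exponents_le_mono)
    moreover have "mon e \<in> carrier (poly_ring F)"
      unfolding mon_def using f by (intro poly_ring_prod poly_ring_power) auto
    ultimately show ?thesis by (auto simp: S_def exponents_le_def mem_carrier_poly_ring)
  qed
  have "card S \<le> (B + 1) ^ d"
    unfolding S_def d_def using F(1) by (rule finite_card_monomial_box)
  also have "\<dots> \<le> ((n * D + 1) * (N + 1)) ^ d"
    by (intro power_mono) (auto simp: B_def algebra_simps)
  also have "\<dots> = N * (N + 1) ^ d" by (simp only: power_mult_distrib N_def)
  also have "\<dots> < (N + 1) ^ (d + 1)" by simp
  also have "\<dots> \<le> (N + 1) ^ n" using F(2) by (intro power_increasing) (auto simp: d_def)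
  also have "\<dots> = card box" by (simp add: box_def card_PiE)
  finally have "card S < card box" .
  moreover have "finite S" unfolding S_def using F(1) by (rule finite_card_monomial_box)
  moreover have fin: "finite box" unfolding box_def by (intro finite_PiE) auto
  ultimately obtain x where x: "\<exists>e\<in>box. x e \<noteq> 0"
    "\<And>m. m \<in> S \<Longrightarrow> (\<Sum>e\<in>box. Poly_Mapping.lookup (mon e) m * x e) = 0"
    using homogeneous_system_nontrivial_solution[of S box "\<lambda>m e. Poly_Mapping.lookup (mon e) m"]
    by auto
  have lookup_scale: "Poly_Mapping.lookup (Poly_Mapping.single 0 a * p) m = a * Poly_Mapping.lookup p m"
    for a :: 'k and p :: "('v, 'k) mpoly" and m
    by (simp add: mult_map_scale_conv_mult[symmetric] Poly_Mapping.map.rep_eq when_def)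
  have zero: "(\<Sum>e\<in>box. Poly_Mapping.single 0 (x e) * mon e) = 0"
  proof (rule poly_mapping_eqI)
    fix m
    have "(\<Sum>e\<in>box. Poly_Mapping.lookup (mon e) m * x e) = 0"
    proof (cases "m \<in> S")
      case False
      then have "Poly_Mapping.lookup (mon e) m = 0" if "e \<in> box" for e
        using keys_mon[OF that] by (auto simp: in_keys_iff)
      then show ?thesis by simp
    qed (rule x(2))
    then show "Poly_Mapping.lookup (\<Sum>e\<in>box. Poly_Mapping.single 0 (x e) * mon e) m =
        Poly_Mapping.lookup 0 m"
      by (simp add: lookup_sum lookup_scale mult.commute[of "x _"])
  qed
  show ?thesis
  proof (rule that[of "{e \<in> box. x e \<noteq> 0}" x])
    show "{e \<in> box. x e \<noteq> 0} \<subseteq> extensional {..<n}"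
      by (auto simp: box_def PiE_def)
    have "(\<Sum>e\<in>{e \<in> box. x e \<noteq> 0}. Poly_Mapping.single 0 (x e) * mon e) =
        (\<Sum>e\<in>box. Poly_Mapping.single 0 (x e) * mon e)"
      using fin by (intro sum.mono_neutral_left) auto
    then show "(\<Sum>e\<in>{e \<in> box. x e \<noteq> 0}. Poly_Mapping.single 0 (x e) *
        (\<Prod>i\<in>{..<n}. f i ^ e i)) = 0"
      using zero by (simp add: mon_def)
  qed (use x(1) fin in auto)
qed

section \<open>The length of chains of prime ideals\<close>

text \<open>A polynomial in \<open>f j, \<dots>, f (n - 1)\<close> with nonzero constant coefficients is not in \<open>P j\<close>, by
  downward induction on \<open>j\<close>. Let \<open>k\<close> be the least exponent of \<open>f j\<close>. The polynomial is
  \<open>f j ^ k * (A + f j * B)\<close> with \<open>A \<noteq> 0\<close> a polynomial in the later \<open>f i\<close> only. The first factor is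
  not in the prime \<open>P j\<close>. The second is not even in \<open>P (Suc j)\<close>, because \<open>f j\<close> is and \<open>A\<close>, by
  induction, is not. The exponent vectors in \<open>E\<close> have to be distinguished by their entries from \<open>j\<close>
  on, since otherwise terms could cancel.\<close>

lemma nonzero_polynomial_notin_chain:
  fixes P :: "nat \<Rightarrow> ('v, 'k :: field) mpoly set"
  assumes prime: "\<And>i. i \<le> n \<Longrightarrow> primeideal (P i) (poly_ring V)"
    and chain: "\<And>i. i < n \<Longrightarrow> P i \<subseteq> P (Suc i)"
    and f: "\<And>i. i < n \<Longrightarrow> f i \<in> P (Suc i)" "\<And>i. i < n \<Longrightarrow> f i \<notin> P i"
    and "j \<le> n" "finite E" "E \<noteq> {}" "\<And>e. e \<in> E \<Longrightarrow> c e \<noteq> 0"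
    and "\<And>e e'. e \<in> E \<Longrightarrow> e' \<in> E \<Longrightarrow> (\<And>i. j \<le> i \<Longrightarrow> i < n \<Longrightarrow> e i = e' i) \<Longrightarrow> e = e'"
  shows "(\<Sum>e\<in>E. Poly_Mapping.single 0 (c e) * (\<Prod>i\<in>{j..<n}. f i ^ e i)) \<notin> P j"
  using assms(5-)
proof (induction j arbitrary: E rule: inc_induct)
  case base
  interpret poly_prime "P n" V by (rule poly_prime.intro) (simp add: prime)
  obtain e where "e \<in> E" using \<open>E \<noteq> {}\<close> by blast
  moreover have "e' = e" if "e' \<in> E" for e'
    using that \<open>e \<in> E\<close> by (rule base.prems(4)) simp
  ultimately have e: "E = {e}" by blast
  have "Poly_Mapping.single 0 (c e) \<notin> P n"
  proof
    assume "Poly_Mapping.single 0 (c e) \<in> P n"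
    then have "Poly_Mapping.single 0 (inverse (c e)) * Poly_Mapping.single 0 (c e) \<in> P n"
      by (intro mult_in poly_ring_const)
    then show False using base.prems(3)[of e] one_notin by (simp add: e mult_single)
  qed
  then show ?case by (simp add: e)
next
  case (step j)
  interpret Pj: poly_prime "P j" V by (rule poly_prime.intro) (use prime step.hyps in simp)
  interpret PS: poly_prime "P (Suc j)" V by (rule poly_prime.intro) (use prime step.hyps in simp)
  have fV: "f i \<in> carrier (poly_ring V)" if "i < n" for i
    using that f(1) prime[of "Suc i"] by (meson Suc_leI ideal.Icarr primeideal.axioms(1))
  define t where "t = (\<lambda>e. Poly_Mapping.single 0 (c e) * (\<Prod>i\<in>{Suc j..<n}. f i ^ e i))"
  have tV: "t e \<in> carrier (poly_ring V)" for e
    unfolding t_def using fV by (intro poly_ring_closed) auto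
  have split: "Poly_Mapping.single 0 (c e) * (\<Prod>i\<in>{j..<n}. f i ^ e i) = f j ^ e j * t e" for e
    using step.hyps by (simp add: t_def prod.atLeast_Suc_lessThan mult.left_commute)
  define k where "k = Min ((\<lambda>e. e j) ` E)"
  have k_le: "k \<le> e j" if "e \<in> E" for e
    using that step.prems by (simp add: k_def)
  define E' where "E' = {e \<in> E. e j = k}"
  have "k \<in> (\<lambda>e. e j) ` E" unfolding k_def using step.prems by (intro Min_in) auto
  then have "E' \<noteq> {}" by (auto simp: E'_def)
  moreover have "e = e'"
    if "e \<in> E'" "e' \<in> E'" "\<And>i. Suc j \<le> i \<Longrightarrow> i < n \<Longrightarrow> e i = e' i" for e e'
  proof (rule step.prems(4))
    show "e i = e' i" if "j \<le> i" "i < n" for i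
      using \<open>e \<in> E'\<close> \<open>e' \<in> E'\<close> \<open>\<And>i. Suc j \<le> i \<Longrightarrow> i < n \<Longrightarrow> e i = e' i\<close>[of i] that
      by (cases "i = j") (auto simp: E'_def)
  qed (use that in \<open>auto simp: E'_def\<close>)
  ultimately have A: "(\<Sum>e\<in>E'. t e) \<notin> P (Suc j)"
    unfolding t_def using step.prems(1,3) by (intro step.IH) (auto simp: E'_def)
  define B where "B = (\<Sum>e\<in>E - E'. f j ^ (e j - k - 1) * t e)"
  have "f j * B \<in> P (Suc j)"
    unfolding B_def using f(1)[OF step.hyps(2)] fV[OF step.hyps(2)] tV
    by (subst mult.commute) (intro PS.mult_in poly_ring_closed, auto)
  then have notin: "(\<Sum>e\<in>E'. t e) + f j * B \<notin> P (Suc j)"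
    using A by (simp add: PS.add_in_iff)
  have eq: "(\<Sum>e\<in>E. f j ^ e j * t e) = f j ^ k * ((\<Sum>e\<in>E'. t e) + f j * B)"
  proof -
    have "(\<Sum>e\<in>E. f j ^ e j * t e) = (\<Sum>e\<in>E'. f j ^ e j * t e) + (\<Sum>e\<in>E - E'. f j ^ e j * t e)"
      using step.prems(1) by (subst add.commute, intro sum.subset_diff) (auto simp: E'_def)
    also have "(\<Sum>e\<in>E'. f j ^ e j * t e) = f j ^ k * (\<Sum>e\<in>E'. t e)"
      by (simp add: E'_def sum_distrib_left)
    also have "(\<Sum>e\<in>E - E'. f j ^ e j * t e) = f j ^ k * (f j * B)"
      unfolding B_def sum_distrib_left
    proof (rule sum.cong)
      fix e assume "e \<in> E - E'"
      then have "k < e j" using k_le[of e] by (auto simp: E'_def)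
      then have "e j = k + (1 + (e j - k - 1))" by simp
      then have "f j ^ e j = f j ^ k * (f j * f j ^ (e j - k - 1))"
        by (metis power_add power_one_right)
      then show "f j ^ e j * t e = f j ^ k * (f j * (f j ^ (e j - k - 1) * t e))"
        by (simp add: ac_simps)
    qed simp
    finally show ?thesis by (simp add: distrib_left)
  qed
  have "f j ^ k \<notin> P j" using f(2) fV step.hyps by (intro Pj.power_notin) auto
  moreover have "(\<Sum>e\<in>E'. t e) + f j * B \<notin> P j" using notin chain step.hyps by blast
  moreover have "f j ^ k \<in> carrier (poly_ring V)"
    "(\<Sum>e\<in>E'. t e) + f j * B \<in> carrier (poly_ring V)"
    unfolding B_def using fV[OF step.hyps(2)] tV by (intro poly_ring_closed; simp)+
  ultimately show ?case unfolding split eq using Pj.cancel_notin_factor by blast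
qed

lemma prime_chain_length_le:
  fixes P :: "nat \<Rightarrow> ('v, 'k :: field) mpoly set"
  assumes F: "finite F"
    and prime: "\<And>i. i \<le> n \<Longrightarrow> primeideal (P i) (poly_ring V)"
    and chain: "\<And>i. i < n \<Longrightarrow> P i \<subset> P (Suc i)"
    and vars: "\<And>v. v \<in> V \<Longrightarrow> v \<notin> F \<Longrightarrow> var v \<in> P 0"
  shows "n \<le> card F"
proof (rule ccontr)
  assume "\<not> n \<le> card F"
  then have less: "card F < n" by simp
  have mono: "P 0 \<subseteq> P i" if "i \<le> n" for i
    using that
  proof (induction i)
    case (Suc i)
    then show ?case using chain[of i] by auto
  qed simp
  \<comment> \<open>The part of an element of \<open>P (Suc i) - P i\<close> that involves variables outside \<open>F\<close> lies in
    \<open>P 0\<close>, so it can be dropped.\<close>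
  have "\<exists>g. g \<in> carrier (poly_ring F) \<and> g \<in> P (Suc i) \<and> g \<notin> P i" if i: "i < n" for i
  proof -
    interpret Pi: poly_prime "P i" V by (rule poly_prime.intro) (use prime i in simp)
    interpret PS: poly_prime "P (Suc i)" V by (rule poly_prime.intro) (use prime i in simp)
    obtain h where h: "h \<in> P (Suc i)" "h \<notin> P i" using chain[OF i] by auto
    obtain a b where ab: "h = a + b" "a \<in> carrier (poly_ring F)" "b \<in> coordinate_ideal V F"
      using PS.Icarr[OF h(1)] by (rule split_by_support)
    have "b \<in> P 0"
      using coordinate_ideal_subset_prime[OF prime[of 0] vars] ab(3) by auto
    then have "b \<in> P i" "b \<in> P (Suc i)" using mono[of i] mono[of "Suc i"] i by auto
    then show ?thesis using h ab by (auto simp: Pi.add_in_iff PS.add_in_iff)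
  qed
  then obtain g where g: "\<And>i. i < n \<Longrightarrow> g i \<in> carrier (poly_ring F)"
    "\<And>i. i < n \<Longrightarrow> g i \<in> P (Suc i)" "\<And>i. i < n \<Longrightarrow> g i \<notin> P i"
    by metis
  obtain E c where E: "finite E" "E \<noteq> {}" "E \<subseteq> extensional {..<n}" "\<And>e. e \<in> E \<Longrightarrow> c e \<noteq> 0"
    "(\<Sum>e\<in>E. Poly_Mapping.single 0 (c e) * (\<Prod>i\<in>{..<n}. g i ^ e i)) = 0"
    by (rule algebraic_dependence[OF F less, of g]) (use g(1) in \<open>simp, blast\<close>)
  have distinct: "e = e'" if "e \<in> E" "e' \<in> E" "\<And>i. i < n \<Longrightarrow> e i = e' i" for e e'
    using that E(3) by (intro extensionalityI[of e "{..<n}" e']) auto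
  have "(\<Sum>e\<in>E. Poly_Mapping.single 0 (c e) * (\<Prod>i\<in>{0..<n}. g i ^ e i)) \<notin> P 0"
  proof (rule nonzero_polynomial_notin_chain[where n = n and V = V])
    show "P i \<subseteq> P (Suc i)" if "i < n" for i using chain[OF that] by blast
    show "e = e'" if "e \<in> E" "e' \<in> E" "\<And>i. 0 \<le> i \<Longrightarrow> i < n \<Longrightarrow> e i = e' i" for e e'
      using that by (intro distinct) auto
  qed (use E(1,2,4) prime g(2,3) in \<open>simp_all\<close>)
  moreover have "0 \<in> P 0" by (rule poly_prime.zero_in[OF poly_prime.intro, OF prime]) simp
  ultimately show False using E(5) by (simp add: atLeast0LessThan)
qed

section \<open>The dimension of a squarefree monomial quotient\<close>

lemma (in cring) primeideal_quot_image:
  assumes I: "ideal I R" and J: "primeideal J R" "I \<subseteq> J"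
  shows "primeideal ((+>) I ` J) (R Quot I)"
proof (rule primeidealI)
  have idJ: "ideal J R" using J(1) by (rule primeideal.axioms(1))
  have mem: "a \<in> J" if "I +> a \<in> (+>) I ` J" "a \<in> carrier R" for a
  proof -
    have "I +> a \<in> (+>) I ` J \<longleftrightarrow> a \<in> \<Union> ((+>) I ` J)"
      using ring_ideal_imp_quot_ideal[OF I idJ]
      by (intro canonical_proj_vimage_mem_iff[symmetric] I that additive_subgroup.a_subset ideal.axioms(1))
    then have "a \<in> (\<Union>j\<in>J. I +> j)" using that(1) by simp
    then show ?thesis by (simp only: ideal_incl_iff[OF I idJ, THEN iffD1, OF J(2), symmetric])
  qed
  show "ideal ((+>) I ` J) (R Quot I)" by (rule ring_ideal_imp_quot_ideal[OF I idJ])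
  show "cring (R Quot I)" using I is_cring by (rule ideal.quotient_is_cring)
  have carr: "\<exists>a\<in>carrier R. x = I +> a" if "x \<in> carrier (R Quot I)" for x
    using that by (auto simp: FactRing_def A_RCOSETS_def')
  have in_carr: "I +> a \<in> carrier (R Quot I)" if "a \<in> carrier R" for a
    using that by (auto simp: FactRing_def A_RCOSETS_def')
  show "carrier (R Quot I) \<noteq> (+>) I ` J"
  proof
    assume "carrier (R Quot I) = (+>) I ` J"
    then have "a \<in> J" if "a \<in> carrier R" for a using mem[OF _ that] in_carr[OF that] by simp
    then have "carrier R = J" using additive_subgroup.a_subset[OF ideal.axioms(1)[OF idJ]] by blast
    then show False using primeideal.I_notcarr[OF J(1)] by simp
  qed
  fix x y assume xy: "x \<in> carrier (R Quot I)" "y \<in> carrier (R Quot I)"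
    "x \<otimes>\<^bsub>R Quot I\<^esub> y \<in> (+>) I ` J"
  obtain a b where ab: "a \<in> carrier R" "b \<in> carrier R" "x = I +> a" "y = I +> b"
    using carr[OF xy(1)] carr[OF xy(2)] by blast
  have "x \<otimes>\<^bsub>R Quot I\<^esub> y = I +> (a \<otimes> b)"
    using ideal.rcoset_mult_add[OF I ab(1,2)] unfolding ab(3,4) by (simp add: FactRing_def)
  then have "a \<otimes> b \<in> J" using mem[of "a \<otimes> b"] xy(3) ab(1,2) by simp
  then have "a \<in> J \<or> b \<in> J" using primeideal.I_prime[OF J(1) ab(1,2)] by simp
  then show "x \<in> (+>) I ` J \<or> y \<in> (+>) I ` J" unfolding ab(3,4) by (auto intro: imageI)
qed

lemma (in cring) primeideal_Union_quot:
  assumes I: "ideal I R" and J: "primeideal J (R Quot I)"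
  shows "primeideal (\<Union> J) R" and "I \<subseteq> \<Union> J" and "(+>) I ` (\<Union> J) = J"
proof -
  have idJ: "ideal J (R Quot I)" using J by (rule primeideal.axioms(1))
  have sub: "J \<subseteq> carrier (R Quot I)"
    using idJ by (intro additive_subgroup.a_subset ideal.axioms(1))
  have eq: "\<Union> J = {a \<in> carrier R. I +> a \<in> J}"
    using canonical_proj_vimage_in_carrier[OF I sub] canonical_proj_vimage_mem_iff[OF I sub] by blast
  show "primeideal (\<Union> J) R"
    unfolding eq by (rule ring_hom_ring.primeideal_vimage[OF ideal.rcos_ring_hom_ring[OF I] is_cring J])
  show "I \<subseteq> \<Union> J"
    using additive_subgroup.zero_closed[OF ideal.axioms(1)[OF idJ]] by (auto simp: FactRing_def)
  have "x \<in> (+>) I ` {a \<in> carrier R. I +> a \<in> J}" if "x \<in> J" for x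
    using that sub by (fastforce simp: FactRing_def A_RCOSETS_def')
  then show "(+>) I ` (\<Union> J) = J" unfolding eq by auto
qed

text \<open>Passing to the quotient and taking unions of cosets are mutually inverse on the primes above \<open>I\<close>,
  so strict inclusions are preserved in both directions.\<close>

lemma (in cring) prime_chain_quot_iff:
  assumes I: "ideal I R"
  shows "(\<exists>P. (\<forall>i\<le>n::nat. primeideal (P i) (R Quot I)) \<and> (\<forall>i<n. P i \<subset> P (Suc i))) \<longleftrightarrow>
    (\<exists>P. (\<forall>i\<le>n. primeideal (P i) R \<and> I \<subseteq> P i) \<and> (\<forall>i<n. P i \<subset> P (Suc i)))"
    (is "?quot \<longleftrightarrow> ?base")
proof
  assume ?quot
  then obtain P where P: "\<And>i. i \<le> n \<Longrightarrow> primeideal (P i) (R Quot I)" "\<And>i. i < n \<Longrightarrow> P i \<subset> P (Suc i)"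
    by blast
  have "\<Union> (P i) \<subset> \<Union> (P (Suc i))" if "i < n" for i
  proof
    show "\<Union> (P i) \<subseteq> \<Union> (P (Suc i))" using P(2)[OF that] by blast
    have "(+>) I ` \<Union> (P i) \<noteq> (+>) I ` \<Union> (P (Suc i))"
      using P(2)[OF that] that by (subst (1 2) primeideal_Union_quot(3)[OF I P(1)]) auto
    then show "\<Union> (P i) \<noteq> \<Union> (P (Suc i))" by metis
  qed
  then show ?base
    using primeideal_Union_quot(1,2)[OF I P(1)] by (intro exI[of _ "\<lambda>i. \<Union> (P i)"]) simp
next
  assume ?base
  then obtain P where P: "\<And>i. i \<le> n \<Longrightarrow> primeideal (P i) R" "\<And>i. i \<le> n \<Longrightarrow> I \<subseteq> P i"
    "\<And>i. i < n \<Longrightarrow> P i \<subset> P (Suc i)" by blast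
  have eq: "\<Union> ((+>) I ` P i) = P i" if "i \<le> n" for i
    using ideal_incl_iff[OF I primeideal.axioms(1)[OF P(1)[OF that]]] P(2)[OF that] by simp
  have "(+>) I ` P i \<subset> (+>) I ` P (Suc i)" if "i < n" for i
  proof
    show "(+>) I ` P i \<subseteq> (+>) I ` P (Suc i)" using P(3)[OF that] by blast
    have "\<Union> ((+>) I ` P i) \<noteq> \<Union> ((+>) I ` P (Suc i))"
      using P(3)[OF that] that by (subst (1 2) eq) auto
    then show "(+>) I ` P i \<noteq> (+>) I ` P (Suc i)" by metis
  qed
  then show ?quot
    using primeideal_quot_image[OF I P(1,2)] by (intro exI[of _ "\<lambda>i. (+>) I ` P i"]) simp
qed

text \<open>The minimal primes of \<open>I\<close> are generated by the variables outside a maximal face, and the quotient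
  by such a prime is a polynomial ring in the variables of the face. The proof compares an arbitrary
  chain with the face of those variables that avoid its smallest member.\<close>

theorem krull_dim_squarefree_monomial_ideal:
  fixes V :: "'v :: linorder set" and G :: "'v set set"
  defines "I \<equiv> Idl\<^bsub>poly_ring V\<^esub> {\<Prod>u\<in>W. var u | W. W \<in> G} :: ('v, 'k :: field) mpoly set"
  assumes V: "finite V" "\<And>W. W \<in> G \<Longrightarrow> W \<subseteq> V"
    and F: "F \<subseteq> V" "\<And>W. W \<in> G \<Longrightarrow> \<not> W \<subseteq> F"
    and max: "\<And>F'. F' \<subseteq> V \<Longrightarrow> (\<And>W. W \<in> G \<Longrightarrow> \<not> W \<subseteq> F') \<Longrightarrow> card F' \<le> card F"
  shows "krull_dim ((poly_ring V :: ('v, 'k) mpoly ring) Quot I) = ereal (real (card F))"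
proof -
  let ?R = "poly_ring V :: ('v, 'k) mpoly ring"
  let ?gens = "{\<Prod>u\<in>W. var u | W. W \<in> G} :: ('v, 'k) mpoly set"
  interpret R: cring ?R by (rule cring_poly_ring)
  have gens: "?gens \<subseteq> carrier ?R"
    using V(2) by (auto intro!: poly_ring_prod poly_ring_var)
  have idI: "ideal I ?R" unfolding I_def by (rule R.genideal_ideal[OF gens])
  have prime_contains: "\<exists>u\<in>W. var u \<in> P" if P: "primeideal P ?R" "I \<subseteq> P" and W: "W \<in> G" for P W
  proof (rule ccontr)
    assume neg: "\<not> ?thesis"
    interpret P: poly_prime P V by (rule poly_prime.intro) fact
    have "(\<Prod>u\<in>W. var u) \<notin> P"
      using neg V(2)[OF W] by (intro P.prod_notin poly_ring_var) auto
    moreover have "(\<Prod>u\<in>W. var u) \<in> I"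
      unfolding I_def using R.genideal_self[OF gens] W by blast
    ultimately show False using P(2) by blast
  qed
  have bound: "n \<le> card F"
    if prime: "\<And>i. i \<le> n \<Longrightarrow> primeideal (P i) ?R" and I: "I \<subseteq> P 0"
      and chain: "\<And>i. i < n \<Longrightarrow> P i \<subset> P (Suc i)" for n and P :: "nat \<Rightarrow> ('v, 'k) mpoly set"
  proof -
    let ?F' = "{v \<in> V. var v \<notin> P 0}"
    have "n \<le> card ?F'"
      using V(1) prime chain by (intro prime_chain_length_le[where V = V and P = P]) auto
    also have "\<dots> \<le> card F"
      using prime_contains[OF prime[of 0] I] by (intro max) auto
    finally show ?thesis .
  qed
  have attained: "\<exists>P. (\<forall>i\<le>card F. primeideal (P i) ?R \<and> I \<subseteq> P i) \<and> (\<forall>i<card F. P i \<subset> P (Suc i))"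
  proof -
    have "finite F" using F(1) V(1) by (rule finite_subset)
    then obtain h where h: "bij_betw h {0..<card F} F" using ex_bij_betw_nat_finite by blast
    \<comment> \<open>The faces shrink by one element at a time, so the ideals of the remaining variables grow.\<close>
    define Fi where "Fi = (\<lambda>i. h ` {i..<card F})"
    have Fi: "Fi i \<subseteq> F" for i
      using bij_betw_imp_surj_on[OF h] by (auto simp: Fi_def)
    have "I \<subseteq> coordinate_ideal V (Fi i)" for i
      unfolding I_def
    proof (rule R.genideal_minimal[OF ideal_coordinate_ideal], clarify)
      fix W assume W: "W \<in> G"
      have fin: "finite W" using V(2)[OF W] V(1) by (rule finite_subset)
      obtain w where w: "w \<in> W" "w \<notin> F" using F(2)[OF W] by blast
      then have "var w \<in> (coordinate_ideal V (Fi i) :: ('v, 'k) mpoly set)"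
        using V(2)[OF W] Fi[of i] by (subst var_mem_coordinate_ideal) auto
      moreover have "(\<Prod>u\<in>W - {w}. var u) \<in> carrier ?R"
        using V(2)[OF W] by (intro poly_ring_prod poly_ring_var) auto
      ultimately have "var w * (\<Prod>u\<in>W - {w}. var u) \<in> (coordinate_ideal V (Fi i) :: ('v, 'k) mpoly set)"
        using ideal.I_r_closed[OF ideal_coordinate_ideal[of V "Fi i"]] by fastforce
      then show "(\<Prod>u\<in>W. var u) \<in> (coordinate_ideal V (Fi i) :: ('v, 'k) mpoly set)"
        using prod.remove[OF fin w(1)] by metis
    qed
    moreover have "coordinate_ideal V (Fi i) \<subset> (coordinate_ideal V (Fi (Suc i)) :: ('v, 'k) mpoly set)"
      if i: "i < card F" for i
    proof
      show "coordinate_ideal V (Fi i) \<subseteq> (coordinate_ideal V (Fi (Suc i)) :: ('v, 'k) mpoly set)"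
        by (rule coordinate_ideal_antimono) (auto simp: Fi_def)
      have "h i \<in> Fi i" using i by (auto simp: Fi_def)
      moreover have "h i \<notin> Fi (Suc i)"
        using bij_betw_imp_inj_on[OF h] i by (auto simp: Fi_def dest: inj_onD)
      moreover have "h i \<in> V" using calculation(1) Fi F(1) by blast
      ultimately have "var (h i) \<in> (coordinate_ideal V (Fi (Suc i)) :: ('v, 'k) mpoly set)"
        "var (h i) \<notin> (coordinate_ideal V (Fi i) :: ('v, 'k) mpoly set)"
        by (simp_all add: var_mem_coordinate_ideal)
      then show "coordinate_ideal V (Fi i) \<noteq> (coordinate_ideal V (Fi (Suc i)) :: ('v, 'k) mpoly set)"
        by metis
    qed
    ultimately show ?thesis
      using primeideal_coordinate_ideal
      by (intro exI[of _ "\<lambda>i. coordinate_ideal V (Fi i)"] conjI allI impI)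
  qed
  show ?thesis
    unfolding krull_dim_def R.prime_chain_quot_iff[OF idI]
  proof (rule cSup_eq_maximum)
    show "ereal (real (card F)) \<in> {ereal (real n) |n. \<exists>P. (\<forall>i\<le>n. primeideal (P i) ?R \<and> I \<subseteq> P i) \<and>
        (\<forall>i<n. P i \<subset> P (Suc i))}"
      using attained by (intro CollectI exI[of _ "card F"] conjI refl)
    fix x assume "x \<in> {ereal (real n) |n. \<exists>P. (\<forall>i\<le>n. primeideal (P i) ?R \<and> I \<subseteq> P i) \<and>
        (\<forall>i<n. P i \<subset> P (Suc i))}"
    then obtain n P where "x = ereal (real n)"
      "\<forall>i\<le>n. primeideal (P i) ?R \<and> I \<subseteq> P i" "\<forall>i<n. P i \<subset> P (Suc i)"
      unfolding mem_Collect_eq by (elim exE conjE)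
    then show "x \<le> ereal (real (card F))" using bound[of n P] by simp
  qed
qed

section \<open>Matchings in complete split graphs\<close>

lemma edge_complete_split_iff:
  "e \<in> edges (complete_split r s) \<longleftrightarrow> (\<exists>u v. e = {u, v} \<and> u < r \<and> v < r + s \<and> u \<noteq> v)"
proof
  assume "e \<in> edges (complete_split r s)"
  then show "\<exists>u v. e = {u, v} \<and> u < r \<and> v < r + s \<and> u \<noteq> v"
    by (fastforce simp: complete_split_def)
next
  assume "\<exists>u v. e = {u, v} \<and> u < r \<and> v < r + s \<and> u \<noteq> v"
  then obtain u v where "e = {u, v}" "u < r" "v < r + s" "u \<noteq> v" by blast
  then show "e \<in> edges (complete_split r s)"
    by (cases "v < r") (auto simp: complete_split_def)
qed

lemma verts_complete_split: "verts (complete_split r s) = {..<r + s}"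
  by (simp add: complete_split_def)

lemma q_matching_complete_split_vertices:
  assumes M: "q_matching (complete_split r s) q M"
  shows "\<Union>M \<subseteq> {..<r + s}" and "card (\<Union>M) = 2 * q" and "q \<le> card (\<Union>M \<inter> {..<r})"
proof -
  have edge: "\<exists>u v. e = {u, v} \<and> u < r \<and> v < r + s \<and> u \<noteq> v" if "e \<in> M" for e
    using M that edge_complete_split_iff by (auto simp: q_matching_def)
  have disj: "disjoint M" "card M = q" using M by (auto simp: q_matching_def)
  show sub: "\<Union>M \<subseteq> {..<r + s}" using edge by fastforce
  have "card (\<Union>M) = sum card M"
    using edge disj(1) by (intro card_Union_disjoint) (fastforce simp: disjnt_def pairwise_def disjoint_def)+
  also have "\<dots> = (\<Sum>e\<in>M. 2)" using edge by (intro sum.cong) fastforce+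
  finally show "card (\<Union>M) = 2 * q" using disj(2) by simp
  \<comment> \<open>Each edge has a clique vertex, and disjoint edges have different ones.\<close>
  have "\<exists>u. u \<in> e \<and> u < r" if "e \<in> M" for e using edge[OF that] by blast
  then obtain g where g: "\<And>e. e \<in> M \<Longrightarrow> g e \<in> e \<and> g e < r" by metis
  have "inj_on g M"
    using g disj(1) by (intro inj_onI) (metis disjoint_def disjoint_iff)
  moreover have "finite (\<Union>M \<inter> {..<r})" by simp
  ultimately have "card M \<le> card (\<Union>M \<inter> {..<r})"
    using g by (intro card_inj_on_le[of g]) auto
  then show "q \<le> card (\<Union>M \<inter> {..<r})" using disj(2) by simp
qed

text \<open>A clique vertex is adjacent to every other vertex, so any bijection from \<open>A\<close> to \<open>T\<close> yields a
  matching.\<close>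

lemma q_matching_complete_split_exists:
  assumes A: "A \<subseteq> {..<r}" "card A = q" and T: "T \<subseteq> {..<r + s}" "card T = q" and AT: "A \<inter> T = {}"
  obtains M where "q_matching (complete_split r s) q M" "\<Union>M = A \<union> T"
proof -
  have fin: "finite A" "finite T" using A(1) T(1) finite_subset by blast+
  then obtain h where h: "bij_betw h A T"
    using A(2) T(2) finite_same_card_bij by metis
  have hT: "h a \<in> T" if "a \<in> A" for a using h that by (rule bij_betw_apply)
  define M where "M = (\<lambda>a. {a, h a}) ` A"
  have ne: "{a, h a} \<inter> {b, h b} = {}" if "a \<in> A" "b \<in> A" "a \<noteq> b" for a b
  proof -
    have "h a \<noteq> h b" using that bij_betw_imp_inj_on[OF h] by (auto dest: inj_onD)
    then show ?thesis using that hT AT by blast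
  qed
  show ?thesis
  proof (rule that[of M])
    have "inj_on (\<lambda>a. {a, h a}) A" using ne by (intro inj_onI) (metis inf.idem insert_not_empty)
    then have "card M = q" using A(2) by (simp add: M_def card_image)
    moreover have "disjoint M"
      unfolding M_def by (rule disjointI) (use ne in \<open>(elim imageE; metis)\<close>)
    moreover have "{a, h a} \<in> edges (complete_split r s)" if "a \<in> A" for a
      using that A(1) T(1) AT hT[OF that] unfolding edge_complete_split_iff
      by (intro exI[of _ a] exI[of _ "h a"]) auto
    ultimately show "q_matching (complete_split r s) q M"
      using fin(1) by (auto simp: q_matching_def M_def)
    show "\<Union>M = A \<union> T" using bij_betw_imp_surj_on[OF h] by (auto simp: M_def)
  qed
qed

lemma contains_matched_set_iff:
  assumes F: "F \<subseteq> {..<r + s}"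
  shows "(\<exists>M. q_matching (complete_split r s) q M \<and> \<Union>M \<subseteq> F) \<longleftrightarrow>
    2 * q \<le> card F \<and> q \<le> card (F \<inter> {..<r})"
proof
  have finF: "finite F" using F by (rule finite_subset) simp
  assume "\<exists>M. q_matching (complete_split r s) q M \<and> \<Union>M \<subseteq> F"
  then obtain M where M: "q_matching (complete_split r s) q M" "\<Union>M \<subseteq> F" by blast
  have "card (\<Union>M) \<le> card F" "card (\<Union>M \<inter> {..<r}) \<le> card (F \<inter> {..<r})"
    using M(2) finF by (auto intro!: card_mono)
  then show "2 * q \<le> card F \<and> q \<le> card (F \<inter> {..<r})"
    using q_matching_complete_split_vertices[OF M(1)] by linarith
next
  assume q: "2 * q \<le> card F \<and> q \<le> card (F \<inter> {..<r})"
  then obtain A where A: "A \<subseteq> F \<inter> {..<r}" "card A = q" by (meson obtain_subset_with_card_n)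
  have "q \<le> card (F - A)"
    using A q by (subst card_Diff_subset) (auto intro: finite_subset)
  then obtain T where T: "T \<subseteq> F - A" "card T = q" by (meson obtain_subset_with_card_n)
  obtain M where "q_matching (complete_split r s) q M" "\<Union>M = A \<union> T"
    by (rule q_matching_complete_split_exists[of A r q T s]) (use A T F in auto)
  then show "\<exists>M. q_matching (complete_split r s) q M \<and> \<Union>M \<subseteq> F" using A T by blast
qed

text \<open>This is the criterion of the preceding lemma for the set of all vertices.\<close>

lemma q_matching_complete_split_ex_iff:
  "(\<exists>M. q_matching (complete_split r s) q M) \<longleftrightarrow> q \<le> min r ((r + s) div 2)"
proof -
  have "{..<r + s} \<inter> {..<r} = {..<r}" by auto
  then have "(\<exists>M. q_matching (complete_split r s) q M \<and> \<Union>M \<subseteq> {..<r + s}) \<longleftrightarrow> 2 * q \<le> r + s \<and> q \<le> r"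
    by (subst contains_matched_set_iff) auto
  then show ?thesis using q_matching_complete_split_vertices(1)[of r s q] by auto
qed

lemma matching_number_complete_split:
  "matching_number (complete_split r s) = min r ((r + s) div 2)"
proof -
  have "{q. \<exists>M. q_matching (complete_split r s) q M} = {..min r ((r + s) div 2)}"
    using q_matching_complete_split_ex_iff by auto
  then show ?thesis
    unfolding matching_number_def by (intro Max_eqI) auto
qed

section \<open>The dimension for complete split graphs\<close>

theorem theorem7p15:
  fixes r s :: nat
  shows "matching_number (complete_split r s) = min r ((r + s) div 2) \<and>
    (\<forall>q. 1 \<le> q \<and> q \<le> matching_number (complete_split r s) \<longrightarrow>
      krull_dim
        ((poly_ring (verts (complete_split r s)) :: (nat, 'k :: field) mpoly ring)
          Quot squarefree_power (complete_split r s) q)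
      = ereal (real ((q - 1) + max q s)))"
proof (intro conjI allI impI)
  show "matching_number (complete_split r s) = min r ((r + s) div 2)"
    by (rule matching_number_complete_split)
  fix q assume "1 \<le> q \<and> q \<le> matching_number (complete_split r s)"
  then have q: "1 \<le> q" "q \<le> r" "2 * q \<le> r + s"
    by (auto simp: matching_number_complete_split)
  define V where "V = {..<r + s}"
  define G where "G = {\<Union>M | M. q_matching (complete_split r s) q M}"
  have face_iff: "(\<forall>W\<in>G. \<not> W \<subseteq> F) \<longleftrightarrow> card F < 2 * q \<or> card (F \<inter> {..<r}) < q"
    if "F \<subseteq> V" for F
    using contains_matched_set_iff[of F r s q] that by (auto simp: G_def V_def not_le)
  \<comment> \<open>A largest face: \<open>q - 1\<close> clique vertices with the whole independent set, or, if that set is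
    smaller than \<open>q\<close>, any \<open>2 * q - 1\<close> vertices.\<close>
  define F where "F = (if q \<le> s then {..<q - 1} \<union> {r..<r + s} else {..<2 * q - 1})"
  have FV: "F \<subseteq> V" using q by (auto simp: F_def V_def)
  have card_F: "card F = (q - 1) + max q s"
  proof (cases "q \<le> s")
    case True
    have "card ({..<q - 1} \<union> {r..<r + s}) = q - 1 + s"
      using q by (subst card_Un_disjoint) auto
    then show ?thesis using True by (simp add: F_def)
  qed (use q in \<open>simp add: F_def\<close>)
  have "card F < 2 * q \<or> card (F \<inter> {..<r}) < q"
  proof (cases "q \<le> s")
    case True
    then have "F \<inter> {..<r} = {..<q - 1}" using q by (auto simp: F_def)
    then show ?thesis using q by simp
  qed (use q in \<open>simp add: F_def\<close>)
  then have face: "\<not> W \<subseteq> F" if "W \<in> G" for W using face_iff[OF FV] that by blast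
  have max: "card F' \<le> card F" if F': "F' \<subseteq> V" "\<And>W. W \<in> G \<Longrightarrow> \<not> W \<subseteq> F'" for F'
  proof -
    have "card F' < 2 * q \<or> card (F' \<inter> {..<r}) < q" using face_iff F' by blast
    moreover have "card F' \<le> card (F' \<inter> {..<r}) + s"
    proof -
      have "card F' \<le> card ((F' \<inter> {..<r}) \<union> {r..<r + s})"
        using F'(1) by (intro card_mono) (auto simp: V_def)
      also have "\<dots> \<le> card (F' \<inter> {..<r}) + s"
        using card_Un_le[of "F' \<inter> {..<r}" "{r..<r + s}"] by simp
      finally show ?thesis .
    qed
    ultimately show ?thesis unfolding card_F by linarith
  qed
  have gens: "{\<Prod>u\<in>\<Union>M. var u | M. q_matching (complete_split r s) q M} =
      ({\<Prod>u\<in>W. var u | W. W \<in> G} :: (nat, 'k) mpoly set)"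
    by (auto simp: G_def)
  have "krull_dim ((poly_ring V :: (nat, 'k) mpoly ring) Quot
      Idl\<^bsub>poly_ring V\<^esub> {\<Prod>u\<in>W. var u | W. W \<in> G}) = ereal (real (card F))"
  proof (rule krull_dim_squarefree_monomial_ideal)
    show "W \<subseteq> V" if "W \<in> G" for W
      using that q_matching_complete_split_vertices(1) unfolding G_def V_def by blast
  qed (use FV face max in \<open>simp_all add: V_def\<close>)
  then show "krull_dim ((poly_ring (verts (complete_split r s)) :: (nat, 'k) mpoly ring)
      Quot squarefree_power (complete_split r s) q) = ereal (real ((q - 1) + max q s))"
    by (simp add: squarefree_power_def verts_complete_split gens card_F flip: V_def)
qed

end
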